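(* Let $(\Omega,\mathcal{A},\mu)$ be a finite measure space, let $X$ be a Banach space, and let $1\le p<\infty$. If $L^p(\mu,X)$ has the Ball Dentable Property ($BDP$), then $X$ has $BDP$.
   Context: All Banach spaces considered are real and nontrivial (including $L^p(\mu,X)$, so $\mu(\Omega)>0$). $B_X$ is the closed unit ball of $X$. $L^p(\mu,X)$ is the Banach space of (classes of) $p$-integrable Lebesgue-Bochner functions $f:\Omega\to X$ with norm $\|f\|_p=\left(\int_\Omega\|f(t)\|^p\,d\mu(t)\right)^{1/p}$. A slice of $B_X$ is a set $S(B_X,x^*,\alpha)=\{x\in B_X: x^*(x)>\sup x^*(B_X)-\alpha\}$ with $x^*\in X^*$, $\|x^*\|=1$, $\alpha>0$. $X$ has $BDP$ if $B_X$ has slices of arbitrarily small diameter (for every $\varepsilon>0$ there is a slice of $B_X$ of diameter less than $\varepsilon$). *)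

theory Defs
  imports "HOL-Analysis.Analysis"
begin

text \<open>
  The space \<open>L\<^sup>p(\<mu>,X)\<close> depends on a measure and an exponent, so it cannot be an instance of the
  type class of normed spaces. Slices and the Ball Dentable Property are therefore defined once,
  for real normed spaces given by an explicit carrier and explicit operations; a space that is a
  type is included through \<open>type_space\<close>.
\<close>

record 'v nspace =
  nv_carrier :: "'v set"
  nv_add :: "'v \<Rightarrow> 'v \<Rightarrow> 'v"
  nv_scale :: "real \<Rightarrow> 'v \<Rightarrow> 'v"
  nv_norm :: "'v \<Rightarrow> real"

definition type_space :: "'x::real_normed_vector nspace" where
  "type_space = \<lparr>nv_carrier = UNIV, nv_add = (+), nv_scale = scaleR, nv_norm = norm\<rparr>"

definition nv_dist :: "'v nspace \<Rightarrow> 'v \<Rightarrow> 'v \<Rightarrow> real" where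
  "nv_dist V x y = nv_norm V (nv_add V x (nv_scale V (- 1) y))"

definition nv_unit_ball :: "'v nspace \<Rightarrow> 'v set" where
  "nv_unit_ball V = {x \<in> nv_carrier V. nv_norm V x \<le> 1}"

definition nv_dual :: "'v nspace \<Rightarrow> ('v \<Rightarrow> real) set" where
  "nv_dual V = {\<phi>.
     (\<forall>x\<in>nv_carrier V. \<forall>y\<in>nv_carrier V. \<phi> (nv_add V x y) = \<phi> x + \<phi> y) \<and>
     (\<forall>c. \<forall>x\<in>nv_carrier V. \<phi> (nv_scale V c x) = c * \<phi> x) \<and>
     (\<exists>K. \<forall>x\<in>nv_carrier V. \<bar>\<phi> x\<bar> \<le> K * nv_norm V x)}"

definition nv_dual_norm :: "'v nspace \<Rightarrow> ('v \<Rightarrow> real) \<Rightarrow> real" where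
  "nv_dual_norm V \<phi> = (SUP x\<in>nv_unit_ball V. \<bar>\<phi> x\<bar>)"

definition slice :: "'v nspace \<Rightarrow> ('v \<Rightarrow> real) \<Rightarrow> real \<Rightarrow> 'v set" where
  "slice V \<phi> \<alpha> = {x \<in> nv_unit_ball V. \<phi> x > (SUP y\<in>nv_unit_ball V. \<phi> y) - \<alpha>}"

definition nv_diameter :: "'v nspace \<Rightarrow> 'v set \<Rightarrow> real" where
  "nv_diameter V S = (SUP (x, y)\<in>S \<times> S. nv_dist V x y)"

text \<open>The suprema above are real-valued. They are only used for nonempty sets that are bounded
  above: the unit ball, and slices of it (nonempty because \<open>\<alpha> > 0\<close>).\<close>

definition BDP :: "'v nspace \<Rightarrow> bool" where
  "BDP V \<longleftrightarrow> (\<forall>\<epsilon>>0. \<exists>\<phi>\<in>nv_dual V. \<exists>\<alpha>>0.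
     nv_dual_norm V \<phi> = 1 \<and> nv_diameter V (slice V \<phi> \<alpha>) < \<epsilon>)"

text \<open>
  Strong (Bochner) measurability. For nonseparable \<open>X\<close> this can be more than Borel measurability.
  The simple functions converge at every point of the measure space: on a measure space that is not
  complete, almost everywhere limits need not be measurable, but they agree almost everywhere with
  an everywhere limit, so both conventions give the same classes.
\<close>

definition strongly_measurable :: "'t measure \<Rightarrow> ('t \<Rightarrow> 'x::real_normed_vector) \<Rightarrow> bool" where
  "strongly_measurable M f \<longleftrightarrow>
     (\<exists>s. (\<forall>n. simple_function M (s n)) \<and> (\<forall>t\<in>space M. (\<lambda>n. s n t) \<longlonglongrightarrow> f t))"

definition Lp_fun :: "'t measure \<Rightarrow> real \<Rightarrow> ('t \<Rightarrow> 'x::real_normed_vector) set" where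
  "Lp_fun M p = {f. strongly_measurable M f \<and> integrable M (\<lambda>t. norm (f t) powr p)}"

definition Lp_eq :: "'t measure \<Rightarrow> real \<Rightarrow> (('t \<Rightarrow> 'x::real_normed_vector) \<times> ('t \<Rightarrow> 'x)) set" where
  "Lp_eq M p = {(f, g). f \<in> Lp_fun M p \<and> g \<in> Lp_fun M p \<and> (AE t in M. f t = g t)}"

definition Lp_norm :: "'t measure \<Rightarrow> real \<Rightarrow> ('t \<Rightarrow> 'x::real_normed_vector) \<Rightarrow> real" where
  "Lp_norm M p f = (LINT t|M. norm (f t) powr p) powr (1 / p)"

definition Lp :: "'t measure \<Rightarrow> real \<Rightarrow> ('t \<Rightarrow> 'x::real_normed_vector) set nspace" where
  "Lp M p = \<lparr>
     nv_carrier = Lp_fun M p // Lp_eq M p,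
     nv_add = (\<lambda>F G. \<Union>f\<in>F. \<Union>g\<in>G. Lp_eq M p `` {\<lambda>t. f t + g t}),
     nv_scale = (\<lambda>c F. \<Union>f\<in>F. Lp_eq M p `` {\<lambda>t. c *\<^sub>R f t}),
     nv_norm = (\<lambda>F. the_elem (Lp_norm M p ` F))\<rparr>"


subsection \<open>For spaces that are types, \<open>BDP\<close> in terms of the library notions\<close>

lemma nv_unit_ball_type_space: "nv_unit_ball type_space = cball 0 1"
  by (auto simp: nv_unit_ball_def type_space_def)

lemma nv_dist_type_space: "nv_dist type_space = dist"
  by (simp add: fun_eq_iff nv_dist_def type_space_def dist_norm)

lemma nv_dual_type_space: "nv_dual type_space = Collect bounded_linear"
proof -
  have "bounded_linear \<phi> \<longleftrightarrow> \<phi> \<in> nv_dual type_space" for \<phi> :: "'a \<Rightarrow> real"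
  proof
    assume b: "bounded_linear \<phi>"
    obtain K where "\<And>x. norm (\<phi> x) \<le> norm x * K"
      using bounded_linear.bounded[OF b] by blast
    then have "\<forall>x. \<bar>\<phi> x\<bar> \<le> K * norm x"
      by (simp add: mult.commute)
    moreover have "\<phi> (x + y) = \<phi> x + \<phi> y" "\<phi> (c *\<^sub>R x) = c * \<phi> x" for x y c
      by (simp_all add: linear_add[OF bounded_linear.linear[OF b]] linear_scale[OF bounded_linear.linear[OF b]])
    ultimately show "\<phi> \<in> nv_dual type_space"
      unfolding nv_dual_def type_space_def by auto
  next
    assume "\<phi> \<in> nv_dual type_space"
    then obtain K where "\<And>x y. \<phi> (x + y) = \<phi> x + \<phi> y" "\<And>c x. \<phi> (c *\<^sub>R x) = c * \<phi> x"
      "\<And>x. \<bar>\<phi> x\<bar> \<le> K * norm x"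
      by (auto simp: nv_dual_def type_space_def)
    then show "bounded_linear \<phi>"
      by (intro bounded_linear_intro[of _ K]) (simp_all add: mult.commute)
  qed
  then show ?thesis by auto
qed

lemma nv_dual_norm_type_space:
  fixes \<phi> :: "'x::real_normed_vector \<Rightarrow>\<^sub>L real"
  shows "nv_dual_norm type_space (blinfun_apply \<phi>) = norm \<phi>"
proof -
  let ?S = "SUP x\<in>cball (0::'x) 1. \<bar>blinfun_apply \<phi> x\<bar>"
  have le: "\<bar>blinfun_apply \<phi> x\<bar> \<le> norm \<phi>" if "x \<in> cball 0 1" for x
  proof -
    have "\<bar>blinfun_apply \<phi> x\<bar> \<le> norm \<phi> * norm x"
      using norm_blinfun[of \<phi> x] by simp
    also have "\<dots> \<le> norm \<phi> * 1"
      using that by (intro mult_left_mono) auto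
    finally show ?thesis by simp
  qed
  have bdd: "bdd_above ((\<lambda>x. \<bar>blinfun_apply \<phi> x\<bar>) ` cball 0 1)"
    using le by (auto intro!: bdd_aboveI2)
  have "?S \<le> norm \<phi>"
    using le by (intro cSUP_least) auto
  moreover have "norm \<phi> \<le> ?S"
  proof (rule norm_blinfun_bound)
    show "0 \<le> ?S"
      using cSUP_upper[OF _ bdd, of 0] by simp
    fix x
    show "norm (blinfun_apply \<phi> x) \<le> ?S * norm x"
    proof (cases "x = 0")
      case False
      have "\<bar>blinfun_apply \<phi> (x /\<^sub>R norm x)\<bar> \<le> ?S"
        using False by (intro cSUP_upper[OF _ bdd]) simp
      then show ?thesis
        using False by (simp add: blinfun.scaleR_right abs_mult field_simps)
    qed simp
  qed
  ultimately show ?thesis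
    by (simp add: nv_dual_norm_def nv_unit_ball_type_space)
qed

lemma slice_type_space:
  "slice type_space \<phi> \<alpha> = {x \<in> cball 0 1. \<phi> x > (SUP y\<in>cball 0 1. \<phi> y) - \<alpha>}"
  by (simp add: slice_def nv_unit_ball_type_space)

lemma slice_type_space_nonempty:
  fixes \<phi> :: "'x::real_normed_vector \<Rightarrow>\<^sub>L real"
  assumes "\<alpha> > 0"
  shows "slice type_space (blinfun_apply \<phi>) \<alpha> \<noteq> {}"
proof -
  let ?S = "SUP y\<in>cball (0::'x) 1. blinfun_apply \<phi> y"
  have "\<exists>x\<in>cball 0 1. ?S - \<alpha> < blinfun_apply \<phi> x"
  proof (rule ccontr)
    assume "\<not> ?thesis"
    then have "?S \<le> ?S - \<alpha>"
      by (intro cSUP_least) (auto simp: not_less)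
    with assms show False by simp
  qed
  then show ?thesis by (auto simp: slice_type_space)
qed

theorem BDP_type_space_iff:
  "BDP (type_space :: 'x::real_normed_vector nspace) \<longleftrightarrow>
     (\<forall>\<epsilon>>0. \<exists>(\<phi> :: 'x \<Rightarrow>\<^sub>L real) \<alpha>. norm \<phi> = 1 \<and> \<alpha> > 0 \<and>
        diameter {x \<in> cball 0 1. blinfun_apply \<phi> x > (SUP y\<in>cball 0 1. blinfun_apply \<phi> y) - \<alpha>} < \<epsilon>)"
proof -
  have ex: "(\<exists>\<phi>\<in>nv_dual (type_space :: 'x nspace). P \<phi>) \<longleftrightarrow> (\<exists>\<phi>::'x \<Rightarrow>\<^sub>L real. P (blinfun_apply \<phi>))" for P
  proof
    assume "\<exists>\<phi>\<in>nv_dual (type_space :: 'x nspace). P \<phi>"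
    then obtain \<phi> :: "'x \<Rightarrow> real" where "bounded_linear \<phi>" "P \<phi>"
      by (auto simp: nv_dual_type_space)
    then have "P (blinfun_apply (Blinfun \<phi>))"
      by (simp add: bounded_linear_Blinfun_apply)
    then show "\<exists>\<phi>::'x \<Rightarrow>\<^sub>L real. P (blinfun_apply \<phi>)" ..
  next
    assume "\<exists>\<phi>::'x \<Rightarrow>\<^sub>L real. P (blinfun_apply \<phi>)"
    then obtain \<phi> :: "'x \<Rightarrow>\<^sub>L real" where "P (blinfun_apply \<phi>)" ..
    moreover have "blinfun_apply \<phi> \<in> nv_dual type_space"
      by (simp add: nv_dual_type_space blinfun.bounded_linear_right)
    ultimately show "\<exists>\<phi>\<in>nv_dual (type_space :: 'x nspace). P \<phi>" by (rule bexI)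
  qed
  have diam: "nv_diameter type_space (slice type_space (blinfun_apply \<phi>) \<alpha>) =
      diameter {x \<in> cball 0 1. blinfun_apply \<phi> x > (SUP y\<in>cball 0 1. blinfun_apply \<phi> y) - \<alpha>}"
    if "\<alpha> > 0" for \<phi> :: "'x \<Rightarrow>\<^sub>L real" and \<alpha>
    using slice_type_space_nonempty[OF that, of \<phi>]
    unfolding nv_diameter_def nv_dist_type_space diameter_def slice_type_space by (simp only: if_False)
  have "(\<exists>\<alpha>>0. norm \<phi> = 1 \<and> nv_diameter type_space (slice type_space (blinfun_apply \<phi>) \<alpha>) < \<epsilon>) \<longleftrightarrow>
      (\<exists>\<alpha>. norm \<phi> = 1 \<and> \<alpha> > 0 \<and>
        diameter {x \<in> cball 0 1. blinfun_apply \<phi> x > (SUP y\<in>cball 0 1. blinfun_apply \<phi> y) - \<alpha>} < \<epsilon>)"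
    for \<phi> :: "'x \<Rightarrow>\<^sub>L real" and \<epsilon>
  proof (intro ex_cong1)
    fix \<alpha> :: real
    show "(\<alpha> > 0 \<and> norm \<phi> = 1 \<and> nv_diameter type_space (slice type_space (blinfun_apply \<phi>) \<alpha>) < \<epsilon>) \<longleftrightarrow>
      (norm \<phi> = 1 \<and> \<alpha> > 0 \<and>
        diameter {x \<in> cball 0 1. blinfun_apply \<phi> x > (SUP y\<in>cball 0 1. blinfun_apply \<phi> y) - \<alpha>} < \<epsilon>)"
      by (cases "\<alpha> > 0") (simp_all only: diam simp_thms)
  qed
  then show ?thesis
    unfolding BDP_def ex nv_dual_norm_type_space by (simp only:)
qed


subsection \<open>The operations on classes are well defined\<close>

lemma strongly_measurable_borel:
  assumes "strongly_measurable M f"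
  shows "f \<in> borel_measurable M"
proof -
  obtain s where s: "\<And>n. simple_function M (s n)" "\<And>t. t \<in> space M \<Longrightarrow> (\<lambda>n. s n t) \<longlonglongrightarrow> f t"
    using assms by (auto simp: strongly_measurable_def)
  have bm: "s n \<in> borel_measurable M" for n
    using measurable_simple_function[OF s(1)] by (auto simp: measurable_def)
  show ?thesis
    by (rule borel_measurable_LIMSEQ_metric[OF bm s(2)])
qed

lemma strongly_measurable_iff_borel:
  fixes f :: "'t \<Rightarrow> 'x::{real_normed_vector, second_countable_topology}"
  shows "strongly_measurable M f \<longleftrightarrow> f \<in> borel_measurable M"
proof
  assume "f \<in> borel_measurable M"
  from borel_measurable_implies_sequence_metric[OF this, of 0]
  show "strongly_measurable M f"
    by (auto simp: strongly_measurable_def)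
qed (rule strongly_measurable_borel)

lemma strongly_measurable_add:
  assumes "strongly_measurable M f" "strongly_measurable M g"
  shows "strongly_measurable M (\<lambda>t. f t + g t)"
proof -
  obtain s where s: "\<And>n. simple_function M (s n)" "\<And>t. t \<in> space M \<Longrightarrow> (\<lambda>n. s n t) \<longlonglongrightarrow> f t"
    using assms(1) by (auto simp: strongly_measurable_def)
  obtain r where r: "\<And>n. simple_function M (r n)" "\<And>t. t \<in> space M \<Longrightarrow> (\<lambda>n. r n t) \<longlonglongrightarrow> g t"
    using assms(2) by (auto simp: strongly_measurable_def)
  show ?thesis
    unfolding strongly_measurable_def
  proof (intro exI[of _ "\<lambda>n t. s n t + r n t"] conjI allI ballI)
    show "simple_function M (\<lambda>t. s n t + r n t)" for n
      using s(1) r(1) by (rule simple_function_compose2)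
    show "(\<lambda>n. s n t + r n t) \<longlonglongrightarrow> f t + g t" if "t \<in> space M" for t
      using s(2)[OF that] r(2)[OF that] by (rule tendsto_add)
  qed
qed

lemma strongly_measurable_scaleR:
  assumes "strongly_measurable M f"
  shows "strongly_measurable M (\<lambda>t. c *\<^sub>R f t)"
proof -
  obtain s where s: "\<And>n. simple_function M (s n)" "\<And>t. t \<in> space M \<Longrightarrow> (\<lambda>n. s n t) \<longlonglongrightarrow> f t"
    using assms by (auto simp: strongly_measurable_def)
  show ?thesis
    unfolding strongly_measurable_def
  proof (intro exI[of _ "\<lambda>n t. c *\<^sub>R s n t"] conjI allI ballI)
    show "simple_function M (\<lambda>t. c *\<^sub>R s n t)" for n
      using s(1) by (rule simple_function_compose1)
    show "(\<lambda>n. c *\<^sub>R s n t) \<longlonglongrightarrow> c *\<^sub>R f t" if "t \<in> space M" for t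
      using tendsto_const s(2)[OF that] by (rule tendsto_scaleR)
  qed
qed

lemma norm_add_powr_le:
  fixes x y :: "'x::real_normed_vector" and p :: real
  assumes "p > 0"
  shows "norm (x + y) powr p \<le> 2 powr p * (norm x powr p + norm y powr p)"
proof -
  have "norm (x + y) powr p \<le> (2 * max (norm x) (norm y)) powr p"
    using assms norm_triangle_ineq[of x y] by (intro powr_mono2) auto
  also have "\<dots> = 2 powr p * max (norm x) (norm y) powr p"
    by (rule powr_mult) 
  also have "\<dots> \<le> 2 powr p * (norm x powr p + norm y powr p)"
    by (intro mult_left_mono) (auto simp: max_def)
  finally show ?thesis .
qed

lemma Lp_fun_add:
  assumes "p > 0" "f \<in> Lp_fun M p" "g \<in> Lp_fun M p"
  shows "(\<lambda>t. f t + g t) \<in> Lp_fun M p"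
proof -
  have sm: "strongly_measurable M (\<lambda>t. f t + g t)"
    using assms by (auto simp: Lp_fun_def strongly_measurable_add)
  have int: "integrable M (\<lambda>t. 2 powr p * (norm (f t) powr p + norm (g t) powr p))"
    using assms by (auto simp: Lp_fun_def)
  have "integrable M (\<lambda>t. norm (f t + g t) powr p)"
  proof (rule Bochner_Integration.integrable_bound[OF int])
    show "(\<lambda>t. norm (f t + g t) powr p) \<in> borel_measurable M"
      using strongly_measurable_borel[OF sm] by measurable
    show "AE t in M. norm (norm (f t + g t) powr p)
        \<le> norm (2 powr p * (norm (f t) powr p + norm (g t) powr p))"
      using norm_add_powr_le[OF assms(1)] by auto
  qed
  with sm show ?thesis by (simp add: Lp_fun_def)
qed

lemma Lp_fun_scaleR:
  assumes "f \<in> Lp_fun M p"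
  shows "(\<lambda>t. c *\<^sub>R f t) \<in> Lp_fun M p"
  using assms by (auto simp: Lp_fun_def strongly_measurable_scaleR powr_mult)

lemma equiv_Lp_eq: "equiv (Lp_fun M p) (Lp_eq M p)"
  by (rule equivI) (auto simp: refl_on_def sym_def trans_def Lp_eq_def)

lemma Lp_norm_cong:
  assumes "(f, g) \<in> Lp_eq M p"
  shows "Lp_norm M p f = Lp_norm M p g"
proof -
  have "(LINT t|M. norm (f t) powr p) = (LINT t|M. norm (g t) powr p)"
    using assms by (intro integral_cong_AE) (auto simp: Lp_eq_def Lp_fun_def)
  then show ?thesis by (simp add: Lp_norm_def)
qed

lemma nv_carrier_Lp: "nv_carrier (Lp M p) = Lp_fun M p // Lp_eq M p"
  by (simp add: Lp_def)

lemma nv_add_Lp: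
  fixes f g :: "'t \<Rightarrow> 'x::real_normed_vector"
  assumes "p > 0" "f \<in> Lp_fun M p" "g \<in> Lp_fun M p"
  shows "nv_add (Lp M p) (Lp_eq M p `` {f}) (Lp_eq M p `` {g}) = Lp_eq M p `` {\<lambda>t. f t + g t}"
proof -
  have "congruent2 (Lp_eq M p) (Lp_eq M p) (\<lambda>f g :: 't \<Rightarrow> 'x. Lp_eq M p `` {\<lambda>t. f t + g t})"
  proof (rule congruent2I')
    fix f f' g g' :: "'t \<Rightarrow> 'x"
    assume *: "(f, f') \<in> Lp_eq M p" "(g, g') \<in> Lp_eq M p"
    then have "AE t in M. f t + g t = f' t + g' t"
      by (auto simp: Lp_eq_def elim: eventually_elim2)
    with * have "(\<lambda>t. f t + g t, \<lambda>t. f' t + g' t) \<in> Lp_eq M p"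
      by (auto simp: Lp_eq_def intro!: Lp_fun_add assms(1))
    then show "Lp_eq M p `` {\<lambda>t. f t + g t} = Lp_eq M p `` {\<lambda>t. f' t + g' t}"
      by (rule equiv_class_eq[OF equiv_Lp_eq])
  qed
  from UN_equiv_class2[OF equiv_Lp_eq equiv_Lp_eq this assms(2,3)] show ?thesis
    by (simp add: Lp_def)
qed

lemma nv_scale_Lp:
  fixes f :: "'t \<Rightarrow> 'x::real_normed_vector"
  assumes "f \<in> Lp_fun M p"
  shows "nv_scale (Lp M p) c (Lp_eq M p `` {f}) = Lp_eq M p `` {\<lambda>t. c *\<^sub>R f t}"
proof -
  have "congruent (Lp_eq M p) (\<lambda>f :: 't \<Rightarrow> 'x. Lp_eq M p `` {\<lambda>t. c *\<^sub>R f t})"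
  proof (rule congruentI)
    fix f f' :: "'t \<Rightarrow> 'x"
    assume *: "(f, f') \<in> Lp_eq M p"
    then have "AE t in M. c *\<^sub>R f t = c *\<^sub>R f' t"
      by (auto simp: Lp_eq_def elim: eventually_mono)
    with * have "(\<lambda>t. c *\<^sub>R f t, \<lambda>t. c *\<^sub>R f' t) \<in> Lp_eq M p"
      by (auto simp: Lp_eq_def intro!: Lp_fun_scaleR)
    then show "Lp_eq M p `` {\<lambda>t. c *\<^sub>R f t} = Lp_eq M p `` {\<lambda>t. c *\<^sub>R f' t}"
      by (rule equiv_class_eq[OF equiv_Lp_eq])
  qed
  from UN_equiv_class[OF equiv_Lp_eq this assms] show ?thesis
    by (simp add: Lp_def)
qed

lemma nv_norm_Lp:
  assumes "f \<in> Lp_fun M p"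
  shows "nv_norm (Lp M p) (Lp_eq M p `` {f}) = Lp_norm M p f"
proof -
  have "the_elem (Lp_norm M p ` (Lp_eq M p `` {f})) = Lp_norm M p f"
  proof (rule the_elem_image_unique)
    show "Lp_eq M p `` {f} \<noteq> {}"
      using equiv_class_self[OF equiv_Lp_eq assms] by blast
    show "Lp_norm M p g = Lp_norm M p f" if "g \<in> Lp_eq M p `` {f}" for g
      using that Lp_norm_cong[of f g M p] by simp
  qed
  then show ?thesis by (simp add: Lp_def)
qed

end

theory Submission
  imports Defs
begin

text \<open>
  The proof is by contraposition. If \<open>X\<close> fails the property, there is \<open>d > 0\<close> such that every bounded
  functional on \<open>X\<close> is nearly maximized over the unit ball at two points of distance at least \<open>d\<close>,
  with an arbitrarily small loss (\<open>not_BDP_imp_distant_near_maximizers\<close>). Then every slice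
  \<open>S(\<phi>,\<alpha>)\<close> of the unit ball of \<open>L\<^sup>p(\<mu>,X)\<close> has diameter at least \<open>d\<close>, as follows.

  Since simple functions are dense, the slice contains a simple function \<open>s\<close> of norm exactly one
  (\<open>Lp_slice_contains_normalized_simple\<close>). Write \<open>s = \<Sum>\<^sub>v 1\<^bsub>A(v)\<^esub> v\<close> with its finitely many level sets
  \<open>A(v)\<close>. Each of them carries the functional \<open>\<psi>\<^sub>v(x) = \<phi>(1\<^bsub>A(v)\<^esub> x)\<close> on \<open>X\<close>, and
  \<open>\<phi>(s) = \<Sum>\<^sub>v \<psi>\<^sub>v(v)\<close> (\<open>Lp_dual_simple\<close>). Take
  near maximizers \<open>Y(v)\<close> and \<open>Z(v)\<close> of \<open>\<psi>\<^sub>v\<close> at distance at least \<open>d\<close>. Replacing every value \<open>v\<close> of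
  \<open>s\<close> by \<open>\<parallel>v\<parallel> Y(v)\<close>, or by \<open>\<parallel>v\<parallel> Z(v)\<close>, does not increase the norm and lowers \<open>\<phi>\<close> by an arbitrarily
  small amount at most, so both new functions lie in the slice. At each point they differ by at
  least \<open>d \<parallel>s(t)\<parallel>\<close>, so their distance is at least \<open>d \<parallel>s\<parallel>\<^sub>p = d\<close>.
\<close>

abbreviation Lp_class :: "'t measure \<Rightarrow> real \<Rightarrow> ('t \<Rightarrow> 'x::real_normed_vector) \<Rightarrow> ('t \<Rightarrow> 'x) set"
  where "Lp_class M p f \<equiv> Lp_eq M p `` {f}"

section \<open>Norm estimates in \<open>L\<^sup>p\<close>\<close>

lemma Lp_norm_nonneg: "0 \<le> Lp_norm M p f"
  by (simp add: Lp_norm_def)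

lemma Lp_norm_mono:
  assumes "p > 0" "f \<in> Lp_fun M p" "g \<in> Lp_fun M p"
    and "\<And>t. t \<in> space M \<Longrightarrow> norm (f t) \<le> norm (g t)"
  shows "Lp_norm M p f \<le> Lp_norm M p g"
proof -
  have "(LINT t|M. norm (f t) powr p) \<le> (LINT t|M. norm (g t) powr p)"
    using assms by (intro integral_mono) (auto simp: Lp_fun_def intro!: powr_mono2)
  then show ?thesis
    using assms(1) unfolding Lp_norm_def by (intro powr_mono2) auto
qed

lemma Lp_norm_scaleR:
  assumes "p > 0"
  shows "Lp_norm M p (\<lambda>t. c *\<^sub>R f t) = \<bar>c\<bar> * Lp_norm M p f"
  using assms by (simp add: Lp_norm_def powr_mult powr_powr)

lemma Lp_norm_const:
  assumes "p > 0"
  shows "Lp_norm M p (\<lambda>_. x) = norm x * measure M (space M) powr (1 / p)"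
  using assms by (simp add: Lp_norm_def powr_mult powr_powr mult.commute)

text \<open>The real-valued supremum that defines the diameter of a subset of the unit ball says nothing
  unless the distances are bounded. For that purpose any bound will do, and integrating the pointwise
  inequality \<open>norm_add_powr_le\<close> gives one.\<close>

lemma Lp_norm_diff_le:
  assumes "p > 0" "f \<in> Lp_fun M p" "g \<in> Lp_fun M p" "Lp_norm M p f \<le> 1" "Lp_norm M p g \<le> 1"
  shows "Lp_norm M p (\<lambda>t. f t + (- 1) *\<^sub>R g t) \<le> (2 powr p * 2) powr (1 / p)"
proof -
  have int_le_1: "(LINT t|M. norm (h t) powr p) \<le> 1" if "Lp_norm M p h \<le> 1" for h :: "'a \<Rightarrow> 'b"
  proof (rule ccontr)
    assume "\<not> ?thesis"
    then have "1 < (LINT t|M. norm (h t) powr p) powr (1 / p)"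
      using assms(1) by simp
    with that show False by (simp add: Lp_norm_def)
  qed
  have int: "integrable M (\<lambda>t. norm (f t) powr p)" "integrable M (\<lambda>t. norm (g t) powr p)"
    using assms by (auto simp: Lp_fun_def)
  have "(LINT t|M. norm (f t + (- 1) *\<^sub>R g t) powr p)
      \<le> (LINT t|M. 2 powr p * (norm (f t) powr p + norm (g t) powr p))"
  proof (rule integral_mono)
    show "integrable M (\<lambda>t. norm (f t + (- 1) *\<^sub>R g t) powr p)"
      using Lp_fun_add[OF assms(1,2) Lp_fun_scaleR[OF assms(3), of "- 1"]] by (simp add: Lp_fun_def)
    show "norm (f t + (- 1) *\<^sub>R g t) powr p \<le> 2 powr p * (norm (f t) powr p + norm (g t) powr p)" for t
      using norm_add_powr_le[OF assms(1), of "f t" "(- 1) *\<^sub>R g t"] by simp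
  qed (use int in auto)
  also have "\<dots> \<le> 2 powr p * 2"
    using int int_le_1[OF assms(4)] int_le_1[OF assms(5)] by simp
  finally show ?thesis
    using assms(1) unfolding Lp_norm_def by (intro powr_mono2) auto
qed


section \<open>Approximation by simple functions\<close>

lemma simple_function_in_Lp_fun:
  assumes "finite_measure M" "simple_function M s" "p > 0"
  shows "s \<in> Lp_fun M p"
proof -
  interpret finite_measure M by fact
  have sm: "strongly_measurable M s"
    using assms(2) unfolding strongly_measurable_def by (intro exI[of _ "\<lambda>_. s"]) auto
  have fin: "finite (s ` space M)"
    using assms(2) by (rule simple_functionD)
  define B where "B = Max (insert 0 ((\<lambda>v. norm v powr p) ` s ` space M))"
  have "norm (s t) powr p \<le> B" if "t \<in> space M" for t
    unfolding B_def using fin that by (intro Max_ge) auto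
  moreover have "(\<lambda>t. norm (s t) powr p) \<in> borel_measurable M"
    using strongly_measurable_borel[OF sm] by measurable
  ultimately have "integrable M (\<lambda>t. norm (s t) powr p)"
    by (intro integrable_const_bound[of _ B]) auto
  with sm show ?thesis by (simp add: Lp_fun_def)
qed

text \<open>The simple functions \<open>r n\<close> that witness measurability may exceed \<open>f\<close> in norm. Shrinking them by
  the factor \<open>c < 1\<close> leaves room: wherever \<open>f t \<noteq> 0\<close>, the inequality \<open>c \<parallel>r n t\<parallel> \<le> \<parallel>f t\<parallel>\<close> holds
  eventually, so cutting off where it fails does not change the limit \<open>c f t\<close>.\<close>

lemma simple_function_approx_dominated:
  assumes "strongly_measurable M f" "0 < c" "c < 1"
  obtains s where "\<And>n. simple_function M (s n)"
    "\<And>n t. t \<in> space M \<Longrightarrow> norm (s n t) \<le> norm (f t)"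
    "\<And>t. t \<in> space M \<Longrightarrow> (\<lambda>n. s n t) \<longlonglongrightarrow> c *\<^sub>R f t"
proof -
  obtain r where r: "\<And>n. simple_function M (r n)" "\<And>t. t \<in> space M \<Longrightarrow> (\<lambda>n. r n t) \<longlonglongrightarrow> f t"
    using assms(1) by (auto simp: strongly_measurable_def)
  define s where "s n t = (if c * norm (r n t) \<le> norm (f t) then c *\<^sub>R r n t else 0)" for n t
  have [measurable]: "f \<in> borel_measurable M"
    using assms(1) by (rule strongly_measurable_borel)
  have [measurable]: "r n \<in> borel_measurable M" for n
    using measurable_simple_function[OF r(1)] by (auto simp: measurable_def)
  show ?thesis
  proof (rule that)
    show "simple_function M (s n)" for n
      unfolding s_def
    proof (rule simple_function_If)
      show "simple_function M (\<lambda>t. c *\<^sub>R r n t)"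
        using r(1) by (rule simple_function_compose1)
    qed auto
    show "norm (s n t) \<le> norm (f t)" for n t
      using assms(2) by (simp add: s_def)
    show "(\<lambda>n. s n t) \<longlonglongrightarrow> c *\<^sub>R f t" if t: "t \<in> space M" for t
    proof (cases "f t = 0")
      case True
      then have "s n t = 0" for n
        using assms(2) by (auto simp: s_def mult_le_0_iff)
      with True show ?thesis by simp
    next
      case False
      have "(\<lambda>n. c * norm (r n t)) \<longlonglongrightarrow> c * norm (f t)"
        by (intro tendsto_intros r(2) t)
      moreover have "c * norm (f t) < norm (f t)"
        using False assms(3) by simp
      ultimately have "\<forall>\<^sub>F n in sequentially. c * norm (r n t) < norm (f t)"
        by (rule order_tendstoD)
      then have "\<forall>\<^sub>F n in sequentially. c *\<^sub>R r n t = s n t"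
        by (rule eventually_mono) (simp add: s_def)
      moreover have "(\<lambda>n. c *\<^sub>R r n t) \<longlonglongrightarrow> c *\<^sub>R f t"
        by (intro tendsto_intros r(2) t)
      ultimately show ?thesis
        by (rule Lim_transform_eventually[rotated])
    qed
  qed
qed

text \<open>Because the approximants are dominated by \<open>f\<close> pointwise, the simple function stays in every ball
  around zero that contains \<open>f\<close>. The price is that it approximates \<open>c f\<close> in place of \<open>f\<close>, which is
  harmless for membership in a slice when \<open>c\<close> is close to one.\<close>

lemma simple_function_dense_Lp:
  assumes "finite_measure M" "p > 0" "f \<in> Lp_fun M p" "0 < c" "c < 1" "\<eta> > 0"
  obtains s where "simple_function M s" "Lp_norm M p s \<le> Lp_norm M p f"
    "Lp_norm M p (\<lambda>t. c *\<^sub>R f t + (- 1) *\<^sub>R s t) < \<eta>"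
proof -
  obtain s where s: "\<And>n. simple_function M (s n)"
    "\<And>n t. t \<in> space M \<Longrightarrow> norm (s n t) \<le> norm (f t)"
    "\<And>t. t \<in> space M \<Longrightarrow> (\<lambda>n. s n t) \<longlonglongrightarrow> c *\<^sub>R f t"
    using simple_function_approx_dominated[of M f c] assms by (auto simp: Lp_fun_def)
  have sL: "s n \<in> Lp_fun M p" for n
    using simple_function_in_Lp_fun[OF assms(1) s(1) assms(2)] .
  have dL: "(\<lambda>t. c *\<^sub>R f t + (- 1) *\<^sub>R s n t) \<in> Lp_fun M p" for n
    by (intro Lp_fun_add Lp_fun_scaleR sL assms)
  have "(\<lambda>n. LINT t|M. norm (c *\<^sub>R f t + (- 1) *\<^sub>R s n t) powr p) \<longlonglongrightarrow> (LINT t|M. 0)"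
  proof (rule integral_dominated_convergence)
    show "integrable M (\<lambda>t. 2 powr p * (norm (f t) powr p + norm (f t) powr p))"
      using assms(3) by (auto simp: Lp_fun_def)
    show "(\<lambda>t. norm (c *\<^sub>R f t + (- 1) *\<^sub>R s n t) powr p) \<in> borel_measurable M" for n
      using dL[of n] by (auto simp: Lp_fun_def)
    show "AE t in M. (\<lambda>n. norm (c *\<^sub>R f t + (- 1) *\<^sub>R s n t) powr p) \<longlonglongrightarrow> 0"
    proof (rule AE_I2)
      fix t assume t: "t \<in> space M"
      have "(\<lambda>n. norm (c *\<^sub>R f t + (- 1) *\<^sub>R s n t)) \<longlonglongrightarrow> norm (c *\<^sub>R f t + (- 1) *\<^sub>R (c *\<^sub>R f t))"
        by (intro tendsto_intros s(3) t)
      then have "(\<lambda>n. norm (c *\<^sub>R f t + (- 1) *\<^sub>R s n t)) \<longlonglongrightarrow> 0" by simp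
      then show "(\<lambda>n. norm (c *\<^sub>R f t + (- 1) *\<^sub>R s n t) powr p) \<longlonglongrightarrow> 0"
        using assms(2) by (intro tendsto_zero_powrI) auto
    qed
    show "AE t in M. norm (norm (c *\<^sub>R f t + (- 1) *\<^sub>R s n t) powr p)
        \<le> 2 powr p * (norm (f t) powr p + norm (f t) powr p)" for n
    proof (rule AE_I2)
      fix t assume t: "t \<in> space M"
      have "norm (c *\<^sub>R f t) powr p \<le> norm (f t) powr p"
        using assms by (intro powr_mono2) (auto intro!: mult_left_le_one_le)
      moreover have "norm ((- 1) *\<^sub>R s n t) powr p \<le> norm (f t) powr p"
        using assms s(2)[OF t, of n] by (intro powr_mono2) auto
      ultimately have "2 powr p * (norm (c *\<^sub>R f t) powr p + norm ((- 1) *\<^sub>R s n t) powr p)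
          \<le> 2 powr p * (norm (f t) powr p + norm (f t) powr p)"
        by (intro mult_left_mono add_mono) auto
      with norm_add_powr_le[OF assms(2)]
      have "norm (c *\<^sub>R f t + (- 1) *\<^sub>R s n t) powr p
          \<le> 2 powr p * (norm (f t) powr p + norm (f t) powr p)"
        by (rule order_trans)
      then show "norm (norm (c *\<^sub>R f t + (- 1) *\<^sub>R s n t) powr p)
        \<le> 2 powr p * (norm (f t) powr p + norm (f t) powr p)" by simp
    qed
  qed auto
  then have "(\<lambda>n. Lp_norm M p (\<lambda>t. c *\<^sub>R f t + (- 1) *\<^sub>R s n t)) \<longlonglongrightarrow> 0"
    using assms(2) unfolding Lp_norm_def by (intro tendsto_zero_powrI[OF _ tendsto_const]) auto
  then have "\<forall>\<^sub>F n in sequentially. Lp_norm M p (\<lambda>t. c *\<^sub>R f t + (- 1) *\<^sub>R s n t) < \<eta>"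
    using assms(6) by (rule order_tendstoD)
  then obtain n where "Lp_norm M p (\<lambda>t. c *\<^sub>R f t + (- 1) *\<^sub>R s n t) < \<eta>"
    by (auto simp: eventually_sequentially)
  moreover have "Lp_norm M p (s n) \<le> Lp_norm M p f"
    using assms(2) sL assms(3) s(2) by (rule Lp_norm_mono)
  ultimately show ?thesis using that s(1) by blast
qed


section \<open>Functionals on \<open>L\<^sup>p\<close>\<close>

lemma Lp_class_in_carrier: "f \<in> Lp_fun M p \<Longrightarrow> Lp_class M p f \<in> nv_carrier (Lp M p)"
  by (simp add: nv_carrier_Lp quotientI)

lemma Lp_class_cong:
  assumes "f \<in> Lp_fun M p" "g \<in> Lp_fun M p" "\<And>t. t \<in> space M \<Longrightarrow> f t = g t"
  shows "Lp_class M p f = Lp_class M p g"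
  using assms by (intro equiv_class_eq[OF equiv_Lp_eq]) (auto simp: Lp_eq_def)

lemma Lp_class_in_unit_ball:
  "f \<in> Lp_fun M p \<Longrightarrow> Lp_class M p f \<in> nv_unit_ball (Lp M p) \<longleftrightarrow> Lp_norm M p f \<le> 1"
  by (simp add: nv_unit_ball_def Lp_class_in_carrier nv_norm_Lp)

lemma Lp_unit_ball_cases:
  assumes "F \<in> nv_unit_ball (Lp M p)"
  obtains f where "f \<in> Lp_fun M p" "F = Lp_class M p f" "Lp_norm M p f \<le> 1"
proof -
  obtain f where f: "f \<in> Lp_fun M p" "F = Lp_class M p f"
    using assms by (auto simp: nv_unit_ball_def nv_carrier_Lp elim: quotientE)
  with that assms show ?thesis by (simp add: Lp_class_in_unit_ball)
qed

lemma nv_dist_Lp: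
  assumes "p > 0" "f \<in> Lp_fun M p" "g \<in> Lp_fun M p"
  shows "nv_dist (Lp M p) (Lp_class M p f) (Lp_class M p g)
    = Lp_norm M p (\<lambda>t. f t + (- 1) *\<^sub>R g t)"
  using assms by (simp add: nv_dist_def nv_scale_Lp nv_add_Lp nv_norm_Lp Lp_fun_add Lp_fun_scaleR
      del: scaleR_minus_left scaleR_minus1_left)

lemma nv_dist_Lp_le_diameter:
  assumes "p > 0" "S \<subseteq> nv_unit_ball (Lp M p)" "F \<in> S" "G \<in> S"
  shows "nv_dist (Lp M p) F G \<le> nv_diameter (Lp M p) S"
proof -
  have "nv_dist (Lp M p) F G \<le> (2 powr p * 2) powr (1 / p)" if FG: "F \<in> S" "G \<in> S" for F G
  proof -
    obtain f where "f \<in> Lp_fun M p" "F = Lp_class M p f" "Lp_norm M p f \<le> 1"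
      using FG assms(2) Lp_unit_ball_cases by blast
    moreover obtain g where "g \<in> Lp_fun M p" "G = Lp_class M p g" "Lp_norm M p g \<le> 1"
      using FG assms(2) Lp_unit_ball_cases by blast
    ultimately show ?thesis
      using assms(1) by (simp only: nv_dist_Lp Lp_norm_diff_le)
  qed
  then have "bdd_above ((\<lambda>(F, G). nv_dist (Lp M p) F G) ` (S \<times> S))"
    by (intro bdd_aboveI2[where M = "(2 powr p * 2) powr (1 / p)"]) auto
  from cSUP_upper[OF _ this, of "(F, G)"] assms(3,4) show ?thesis
    by (simp add: nv_diameter_def)
qed

lemma Lp_dual_add:
  assumes "\<phi> \<in> nv_dual (Lp M p)" "p > 0" "f \<in> Lp_fun M p" "g \<in> Lp_fun M p"
  shows "\<phi> (Lp_class M p (\<lambda>t. f t + g t)) = \<phi> (Lp_class M p f) + \<phi> (Lp_class M p g)"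
  using assms Lp_class_in_carrier[OF assms(3)] Lp_class_in_carrier[OF assms(4)]
  by (simp add: nv_dual_def flip: nv_add_Lp)

lemma Lp_dual_scaleR:
  assumes "\<phi> \<in> nv_dual (Lp M p)" "f \<in> Lp_fun M p"
  shows "\<phi> (Lp_class M p (\<lambda>t. c *\<^sub>R f t)) = c * \<phi> (Lp_class M p f)"
  using assms Lp_class_in_carrier[OF assms(2)]
  by (simp add: nv_dual_def flip: nv_scale_Lp)

lemma Lp_dual_bounded:
  fixes \<phi> :: "('t \<Rightarrow> 'x::real_normed_vector) set \<Rightarrow> real"
  assumes "\<phi> \<in> nv_dual (Lp M p)"
  obtains K where "K > 0" "\<And>f. f \<in> Lp_fun M p \<Longrightarrow> \<bar>\<phi> (Lp_class M p f)\<bar> \<le> K * Lp_norm M p f"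
proof -
  obtain K where K: "\<And>F. F \<in> nv_carrier (Lp M p) \<Longrightarrow> \<bar>\<phi> F\<bar> \<le> K * nv_norm (Lp M p) F"
    using assms unfolding nv_dual_def by blast
  show ?thesis
  proof (rule that[of "\<bar>K\<bar> + 1"])
    fix f :: "'t \<Rightarrow> 'x" assume f: "f \<in> Lp_fun M p"
    have "\<bar>\<phi> (Lp_class M p f)\<bar> \<le> K * Lp_norm M p f"
      using K[OF Lp_class_in_carrier[OF f]] f by (simp add: nv_norm_Lp)
    also have "\<dots> \<le> (\<bar>K\<bar> + 1) * Lp_norm M p f"
      by (intro mult_right_mono) (auto simp: Lp_norm_nonneg)
    finally show "\<bar>\<phi> (Lp_class M p f)\<bar> \<le> (\<bar>K\<bar> + 1) * Lp_norm M p f" .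
  qed simp
qed

lemma Lp_fun_zero: "(\<lambda>_. 0) \<in> Lp_fun M p"
  unfolding Lp_fun_def strongly_measurable_def by (auto intro!: exI[of _ "\<lambda>_ _. 0"])

lemma Lp_dual_sum:
  fixes f :: "'i \<Rightarrow> 't \<Rightarrow> 'x::real_normed_vector"
  assumes "\<phi> \<in> nv_dual (Lp M p)" "p > 0" "finite I" "\<And>i. i \<in> I \<Longrightarrow> f i \<in> Lp_fun M p"
  shows "(\<lambda>t. \<Sum>i\<in>I. f i t) \<in> Lp_fun M p \<and>
    \<phi> (Lp_class M p (\<lambda>t. \<Sum>i\<in>I. f i t)) = (\<Sum>i\<in>I. \<phi> (Lp_class M p (f i)))"
  using assms(3,4)
proof (induction I rule: finite_induct)
  case empty
  then show ?case
    using Lp_fun_zero[of M p] Lp_dual_scaleR[OF assms(1) Lp_fun_zero, of 0] by simp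
next
  case (insert i I)
  then have fi: "f i \<in> Lp_fun M p" and I: "(\<lambda>t. \<Sum>i\<in>I. f i t) \<in> Lp_fun M p"
    "\<phi> (Lp_class M p (\<lambda>t. \<Sum>i\<in>I. f i t)) = (\<Sum>i\<in>I. \<phi> (Lp_class M p (f i)))"
    by auto
  show ?case
    using insert(1,2) Lp_fun_add[OF assms(2) fi I(1)] Lp_dual_add[OF assms(1,2) fi I(1)] I(2)
    by simp
qed

text \<open>Here \<open>\<phi>\<close> splits into finitely many functionals on \<open>X\<close>, one for each level set of \<open>s\<close>. The map
  \<open>k\<close> is arbitrary so that the same level sets serve for \<open>s\<close> and for every function obtained from \<open>s\<close>
  by changing its values.\<close>

lemma Lp_dual_simple:
  fixes s :: "'t \<Rightarrow> 'x::real_normed_vector" and k :: "'x \<Rightarrow> 'x"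
  assumes "finite_measure M" "p > 0" "\<phi> \<in> nv_dual (Lp M p)" "simple_function M s"
  shows "\<phi> (Lp_class M p (\<lambda>t. k (s t))) =
    (\<Sum>v\<in>s ` space M. \<phi> (Lp_class M p (\<lambda>t. indicator (s -` {v} \<inter> space M) t *\<^sub>R k v)))"
proof -
  let ?f = "\<lambda>v t. indicator (s -` {v} \<inter> space M) t *\<^sub>R k v"
  have fin: "finite (s ` space M)" and meas: "\<And>v. s -` {v} \<inter> space M \<in> sets M"
    using simple_functionD[OF assms(4)] by auto
  have L: "h \<in> Lp_fun M p" if "simple_function M h" for h :: "'t \<Rightarrow> 'x"
    using simple_function_in_Lp_fun[OF assms(1) that assms(2)] .
  have f: "?f v \<in> Lp_fun M p" for v
    by (intro L simple_function_compose1[OF simple_function_indicator[OF meas]])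
  note sum = Lp_dual_sum[OF assms(3,2) fin, of ?f, OF f]
  have "k (s t) = (\<Sum>v\<in>s ` space M. ?f v t)" if "t \<in> space M" for t
  proof -
    have "(\<Sum>v\<in>s ` space M. ?f v t) = (\<Sum>v\<in>s ` space M. if v = s t then k v else 0)"
      using that by (intro sum.cong) (auto simp: indicator_def)
    with fin that show ?thesis by simp
  qed
  then have "Lp_class M p (\<lambda>t. k (s t)) = Lp_class M p (\<lambda>t. \<Sum>v\<in>s ` space M. ?f v t)"
    using sum by (intro Lp_class_cong L[OF simple_function_compose1[OF assms(4)]]) auto
  with sum show ?thesis by simp
qed

lemma bounded_linear_Lp_dual_indicator:
  fixes \<phi> :: "('t \<Rightarrow> 'x::real_normed_vector) set \<Rightarrow> real"
  assumes "finite_measure M" "p > 0" "\<phi> \<in> nv_dual (Lp M p)" "A \<in> sets M"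
  shows "bounded_linear (\<lambda>x. \<phi> (Lp_class M p (\<lambda>t. indicator A t *\<^sub>R x)))"
proof -
  have L: "h \<in> Lp_fun M p" if "simple_function M h" for h :: "'t \<Rightarrow> 'x"
    using simple_function_in_Lp_fun[OF assms(1) that assms(2)] .
  have I: "(\<lambda>t. indicator A t *\<^sub>R x) \<in> Lp_fun M p" for x :: 'x
    by (intro L simple_function_compose1[OF simple_function_indicator[OF assms(4)]])
  obtain K where K: "K > 0" "\<And>f. f \<in> Lp_fun M p \<Longrightarrow> \<bar>\<phi> (Lp_class M p f)\<bar> \<le> K * Lp_norm M p f"
    using Lp_dual_bounded[OF assms(3)] by blast
  show ?thesis
  proof (rule bounded_linear_intro[where K = "K * measure M (space M) powr (1 / p)"])
    show "\<phi> (Lp_class M p (\<lambda>t. indicator A t *\<^sub>R (x + y))) =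
      \<phi> (Lp_class M p (\<lambda>t. indicator A t *\<^sub>R x)) + \<phi> (Lp_class M p (\<lambda>t. indicator A t *\<^sub>R y))" for x y
      using Lp_dual_add[OF assms(3,2) I I] by (simp add: scaleR_add_right)
    show "\<phi> (Lp_class M p (\<lambda>t. indicator A t *\<^sub>R (r *\<^sub>R x))) =
      r *\<^sub>R \<phi> (Lp_class M p (\<lambda>t. indicator A t *\<^sub>R x))" for r x
      using Lp_dual_scaleR[OF assms(3) I, of r] by (simp add: mult.commute)
    show "norm (\<phi> (Lp_class M p (\<lambda>t. indicator A t *\<^sub>R x)))
      \<le> norm x * (K * measure M (space M) powr (1 / p))" for x
    proof -
      have "Lp_norm M p (\<lambda>t. indicator A t *\<^sub>R x) \<le> Lp_norm M p (\<lambda>_. x)"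
        by (intro Lp_norm_mono[OF assms(2)] I L) (auto simp: indicator_def)
      with K(1) have "K * Lp_norm M p (\<lambda>t. indicator A t *\<^sub>R x) \<le> K * Lp_norm M p (\<lambda>_. x)"
        by simp
      with K(2)[OF I, of x] show ?thesis
        by (simp add: Lp_norm_const[OF assms(2)] mult_ac)
    qed
  qed
qed


section \<open>Near maximizers of a functional\<close>

text \<open>For \<open>\<psi> \<noteq> 0\<close> this is the largeness of all slices, applied to \<open>\<psi> / \<parallel>\<psi>\<parallel>\<close> with the width \<open>\<beta> / \<parallel>\<psi>\<parallel>\<close>.
  The functional zero has to be included, since \<open>\<phi>\<close> may vanish on the functions that live on one
  level set; every point maximizes it, so an antipodal pair of unit vectors will do. That pair caps
  \<open>d\<close> at 2.\<close>

lemma not_BDP_imp_distant_near_maximizers: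
  assumes "\<exists>x :: 'x::real_normed_vector. x \<noteq> 0"
    and "\<not> BDP (type_space :: 'x nspace)"
  obtains d :: real where "d > 0"
    "\<And>(\<psi> :: 'x \<Rightarrow> real) \<beta>. bounded_linear \<psi> \<Longrightarrow> \<beta> > 0 \<Longrightarrow>
      \<exists>y z. norm y \<le> 1 \<and> norm z \<le> 1 \<and> d \<le> norm (y - z) \<and>
        (\<forall>x. norm x \<le> 1 \<longrightarrow> \<psi> x \<le> \<psi> y + \<beta> \<and> \<psi> x \<le> \<psi> z + \<beta>)"
proof -
  obtain \<epsilon> where eps: "\<epsilon> > 0" "\<And>(\<phi> :: 'x \<Rightarrow>\<^sub>L real) \<alpha>. norm \<phi> = 1 \<Longrightarrow> \<alpha> > 0 \<Longrightarrow>
      \<epsilon> \<le> diameter {x \<in> cball 0 1. blinfun_apply \<phi> x > (SUP y\<in>cball 0 1. blinfun_apply \<phi> y) - \<alpha>}"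
    using assms(2) unfolding BDP_type_space_iff by (meson not_le)
  show ?thesis
  proof (rule that[of "min (\<epsilon> / 2) 2"])
    show "min (\<epsilon> / 2) 2 > 0" using eps(1) by simp
    fix \<psi> :: "'x \<Rightarrow> real" and \<beta> :: real
    assume psi: "bounded_linear \<psi>" and beta: "\<beta> > 0"
    define \<Psi> where "\<Psi> = Blinfun \<psi>"
    have Psi: "blinfun_apply \<Psi> = \<psi>"
      using psi by (simp add: \<Psi>_def bounded_linear_Blinfun_apply)
    show "\<exists>y z. norm y \<le> 1 \<and> norm z \<le> 1 \<and> min (\<epsilon> / 2) 2 \<le> norm (y - z) \<and>
        (\<forall>x. norm x \<le> 1 \<longrightarrow> \<psi> x \<le> \<psi> y + \<beta> \<and> \<psi> x \<le> \<psi> z + \<beta>)"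
    proof (cases "\<Psi> = 0")
      case True
      obtain u :: 'x where u: "norm u = 1"
      proof -
        obtain x :: 'x where "x \<noteq> 0" using assms(1) by blast
        then show ?thesis by (intro that[of "x /\<^sub>R norm x"]) simp
      qed
      have "norm (u - (- u)) = 2"
        using u by (simp flip: scaleR_2)
      moreover have "\<psi> x = 0" for x
        using True Psi by (metis blinfun.zero_left)
      ultimately show ?thesis
        using u beta by (intro exI[of _ u] exI[of _ "- u"]) auto
    next
      case False
      define \<phi> where "\<phi> = \<Psi> /\<^sub>R norm \<Psi>"
      have phi: "norm \<phi> = 1" "\<psi> x = norm \<Psi> * blinfun_apply \<phi> x" for x
        using False by (auto simp: \<phi>_def blinfun.scaleR_left Psi)
      define S where "S = {x \<in> cball 0 1. blinfun_apply \<phi> x >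
        (SUP y\<in>cball 0 1. blinfun_apply \<phi> y) - \<beta> / norm \<Psi>}"
      have "\<epsilon> \<le> diameter S"
        unfolding S_def using False beta by (intro eps(2) phi) simp
      then have "\<epsilon> / 2 < diameter S" "bounded S" "0 < \<epsilon> / 2"
        using eps(1) by (auto simp: S_def intro: bounded_subset[OF bounded_cball[of 0 1]])
      then obtain y z where yz: "y \<in> S" "z \<in> S" "\<epsilon> / 2 < dist y z"
        using diameter_lower_bounded by blast
      have bdd: "bdd_above (blinfun_apply \<phi> ` cball 0 1)"
        by (intro bounded_imp_bdd_above bounded_linear_image bounded_cball blinfun.bounded_linear_right)
      have max: "\<psi> x \<le> \<psi> y + \<beta>" if "y \<in> S" "norm x \<le> 1" for x y
      proof -
        have "blinfun_apply \<phi> x \<le> (SUP y\<in>cball 0 1. blinfun_apply \<phi> y)"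
          using that by (intro cSUP_upper bdd) auto
        also have "\<dots> \<le> blinfun_apply \<phi> y + \<beta> / norm \<Psi>"
          using that by (simp add: S_def)
        finally have "norm \<Psi> * blinfun_apply \<phi> x \<le> norm \<Psi> * (blinfun_apply \<phi> y + \<beta> / norm \<Psi>)"
          by (rule mult_left_mono) simp
        with False show ?thesis by (simp add: phi(2) distrib_left)
      qed
      show ?thesis
        using yz max by (intro exI[of _ y] exI[of _ z]) (auto simp: S_def dist_norm)
    qed
  qed
qed

text \<open>Dividing by the norm moves a point of the ball deeper into the slice as long as \<open>\<phi>\<close> is positive
  there. Therefore the simple function is sought where \<open>\<phi>\<close> exceeds both \<open>sup \<phi> - \<alpha>\<close> and zero, which
  is possible because \<open>sup \<phi>\<close> is positive: \<open>\<phi>\<close> does not vanish on the ball, and the ball is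
  symmetric.\<close>

lemma Lp_slice_contains_normalized_simple:
  fixes \<phi> :: "('t \<Rightarrow> 'x::real_normed_vector) set \<Rightarrow> real"
  assumes "finite_measure M" "p > 0" "\<phi> \<in> nv_dual (Lp M p)" "nv_dual_norm (Lp M p) \<phi> = 1" "\<alpha> > 0"
  obtains s where "simple_function M s" "Lp_norm M p s = 1"
    "\<phi> (Lp_class M p s) > (SUP F\<in>nv_unit_ball (Lp M p). \<phi> F) - \<alpha>"
proof -
  define B where "B = nv_unit_ball (Lp M p :: ('t \<Rightarrow> 'x) set nspace)"
  define S where "S = (SUP F\<in>B. \<phi> F)"
  have L: "h \<in> Lp_fun M p" if "simple_function M h" for h :: "'t \<Rightarrow> 'x"
    using simple_function_in_Lp_fun[OF assms(1) that assms(2)] .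
  obtain K where K: "K > 0" "\<And>f. f \<in> Lp_fun M p \<Longrightarrow> \<bar>\<phi> (Lp_class M p f)\<bar> \<le> K * Lp_norm M p f"
    using Lp_dual_bounded[OF assms(3)] by blast
  have KB: "\<bar>\<phi> F\<bar> \<le> K" if "F \<in> B" for F
  proof -
    obtain f where f: "f \<in> Lp_fun M p" "F = Lp_class M p f" "Lp_norm M p f \<le> 1"
      using \<open>F \<in> B\<close> Lp_unit_ball_cases unfolding B_def by blast
    have "K * Lp_norm M p f \<le> K * 1"
      using f K(1) by (intro mult_left_mono) auto
    with K(2)[OF f(1)] f(2) show ?thesis by simp
  qed
  have bdd: "bdd_above (\<phi> ` B)"
    using KB by (intro bdd_aboveI2[where M = K]) (meson abs_le_D1)
  have ne: "B \<noteq> {}"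
    using Lp_class_in_unit_ball[OF L[of "\<lambda>_. 0"]] Lp_norm_scaleR[OF assms(2), of M 0 "\<lambda>_. 0 :: 'x"]
    by (auto simp: B_def)
  have "S > 0"
  proof -
    have "\<exists>F\<in>B. 0 < \<bar>\<phi> F\<bar>"
    proof (rule ccontr)
      assume "\<not> ?thesis"
      then have "(SUP F\<in>B. \<bar>\<phi> F\<bar>) \<le> 0"
        using ne by (intro cSUP_least) auto
      with assms(4) show False by (simp add: nv_dual_norm_def B_def)
    qed
    then obtain F where F: "F \<in> B" "\<phi> F \<noteq> 0" by auto
    then obtain f where f: "f \<in> Lp_fun M p" "F = Lp_class M p f" "Lp_norm M p f \<le> 1"
      using Lp_unit_ball_cases unfolding B_def by blast
    define G where "G = Lp_class M p (\<lambda>t. sgn (\<phi> F) *\<^sub>R f t)"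
    have "G \<in> B"
      using f by (simp add: G_def B_def Lp_class_in_unit_ball Lp_fun_scaleR Lp_norm_scaleR assms(2)
          abs_sgn_eq)
    moreover have "\<phi> G > 0"
      using Lp_dual_scaleR[OF assms(3) f(1)] f(2) F(2) by (simp add: G_def sgn_if)
    ultimately show ?thesis
      unfolding S_def using cSUP_upper[OF _ bdd] by fastforce
  qed
  \<comment> \<open>The threshold that \<open>\<phi>\<close> must exceed, for the slice and for positivity at once.\<close>
  define \<theta> where "\<theta> = max (S - \<alpha>) 0"
  have "\<theta> < (SUP F\<in>B. \<phi> F)"
    using \<open>S > 0\<close> assms(5) by (simp add: \<theta>_def S_def)
  then obtain F where F: "F \<in> B" "\<theta> < \<phi> F"
    using less_cSUP_iff[OF ne bdd] by blast
  then obtain f where f: "f \<in> Lp_fun M p" "F = Lp_class M p f" "Lp_norm M p f \<le> 1"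
    using Lp_unit_ball_cases unfolding B_def by blast
  have pos: "\<phi> F > 0" "\<theta> \<ge> 0" using F by (auto simp: \<theta>_def)
  obtain c where c: "0 < c" "c < 1" "\<theta> < c * \<phi> F"
  proof -
    have "\<theta> / \<phi> F < 1" using F pos by simp
    then obtain c where "\<theta> / \<phi> F < c" "c < 1" using dense by blast
    moreover from this have "0 < c" using pos by (meson divide_nonneg_pos le_less_trans)
    ultimately show ?thesis using pos that by (simp add: field_simps)
  qed
  obtain s where s: "simple_function M s" "Lp_norm M p s \<le> Lp_norm M p f"
    "Lp_norm M p (\<lambda>t. c *\<^sub>R f t + (- 1) *\<^sub>R s t) < (c * \<phi> F - \<theta>) / K"
    using simple_function_dense_Lp[OF assms(1,2) f(1) c(1,2), of "(c * \<phi> F - \<theta>) / K"] c K(1) by auto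
  have cf: "(\<lambda>t. c *\<^sub>R f t) \<in> Lp_fun M p" and ms: "(\<lambda>t. (- 1) *\<^sub>R s t) \<in> Lp_fun M p"
    by (intro Lp_fun_scaleR f(1) L s(1))+
  have "c * \<phi> F - \<phi> (Lp_class M p s) = \<phi> (Lp_class M p (\<lambda>t. c *\<^sub>R f t + (- 1) *\<^sub>R s t))"
    unfolding Lp_dual_add[OF assms(3,2) cf ms] Lp_dual_scaleR[OF assms(3) f(1)]
      Lp_dual_scaleR[OF assms(3) L[OF s(1)]] using f(2) by simp
  also have "\<dots> \<le> K * Lp_norm M p (\<lambda>t. c *\<^sub>R f t + (- 1) *\<^sub>R s t)"
    using K(2)[OF Lp_fun_add[OF assms(2) cf ms]] by linarith
  also have "\<dots> < c * \<phi> F - \<theta>"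
    using s(3) K(1) by (simp add: field_simps)
  finally have phis: "\<theta> < \<phi> (Lp_class M p s)" by simp
  define N where "N = Lp_norm M p s"
  have N: "0 < N" "N \<le> 1"
  proof -
    have "0 < K * N"
      using K(2)[OF L[OF s(1)]] phis pos by (simp add: N_def)
    then show "0 < N" using K(1) by (simp add: zero_less_mult_iff)
    show "N \<le> 1" using s(2) f(3) by (simp add: N_def)
  qed
  show ?thesis
  proof (rule that)
    show "simple_function M (\<lambda>t. (1 / N) *\<^sub>R s t)"
      using s(1) by (rule simple_function_compose1)
    show "Lp_norm M p (\<lambda>t. (1 / N) *\<^sub>R s t) = 1"
      using N by (simp add: Lp_norm_scaleR assms(2) flip: N_def)
    have "\<phi> (Lp_class M p s) \<le> (1 / N) * \<phi> (Lp_class M p s)"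
      using N phis pos by (simp add: field_simps)
    then show "\<phi> (Lp_class M p (\<lambda>t. (1 / N) *\<^sub>R s t)) > (SUP F\<in>nv_unit_ball (Lp M p). \<phi> F) - \<alpha>"
      unfolding Lp_dual_scaleR[OF assms(3) L[OF s(1)]]
      using phis by (simp add: \<theta>_def S_def B_def)
  qed
qed

section \<open>Transfer of the Ball Dentable Property\<close>

theorem proposition3p2:
  fixes M :: "'t measure" and p :: real
  assumes "finite_measure M"
    and "emeasure M (space M) > 0"
    and "\<exists>x :: 'x::banach. x \<noteq> 0"
    and "1 \<le> p"
    and "BDP (Lp M p :: ('t \<Rightarrow> 'x) set nspace)"
  shows "BDP (type_space :: 'x nspace)"
proof (rule ccontr)
  assume notBDP: "\<not> ?thesis"
  have p: "p > 0" using assms(4) by simp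
  have L: "h \<in> Lp_fun M p" if "simple_function M h" for h :: "'t \<Rightarrow> 'x"
    using simple_function_in_Lp_fun[OF assms(1) that p] .
  obtain d :: real where "d > 0"
    and d: "\<And>(\<psi> :: 'x \<Rightarrow> real) \<beta>. bounded_linear \<psi> \<Longrightarrow> \<beta> > 0 \<Longrightarrow>
      \<exists>y z. norm y \<le> 1 \<and> norm z \<le> 1 \<and> d \<le> norm (y - z) \<and>
        (\<forall>x. norm x \<le> 1 \<longrightarrow> \<psi> x \<le> \<psi> y + \<beta> \<and> \<psi> x \<le> \<psi> z + \<beta>)"
    using not_BDP_imp_distant_near_maximizers[OF assms(3) notBDP] by blast
  obtain \<phi> \<alpha> where phi: "\<phi> \<in> nv_dual (Lp M p :: ('t \<Rightarrow> 'x) set nspace)" "\<alpha> > 0"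
    "nv_dual_norm (Lp M p) \<phi> = 1" "nv_diameter (Lp M p) (slice (Lp M p) \<phi> \<alpha>) < d"
    using assms(5) \<open>d > 0\<close> unfolding BDP_def by blast
  obtain s where s: "simple_function M s" "Lp_norm M p s = 1"
    "\<phi> (Lp_class M p s) > (SUP F\<in>nv_unit_ball (Lp M p). \<phi> F) - \<alpha>"
    using Lp_slice_contains_normalized_simple[OF assms(1) p phi(1,3,2)] by blast
  define V where "V = s ` space M"
  have fin: "finite V" using simple_functionD(1)[OF s(1)] by (simp add: V_def)
  define \<psi> where "\<psi> v x = \<phi> (Lp_class M p (\<lambda>t. indicator (s -` {v} \<inter> space M) t *\<^sub>R x))" for v x
  have psi: "bounded_linear (\<psi> v)" for v
    unfolding \<psi>_def
    by (rule bounded_linear_Lp_dual_indicator[OF assms(1) p phi(1) simple_functionD(2)[OF s(1)]])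
  have split: "\<phi> (Lp_class M p (\<lambda>t. k (s t))) = (\<Sum>v\<in>V. \<psi> v (k v))" for k
    unfolding \<psi>_def V_def by (rule Lp_dual_simple[OF assms(1) p phi(1) s(1)])
  \<comment> \<open>The surplus \<open>\<tau>\<close> of \<open>s\<close> over the threshold of the slice is distributed over the level sets:
    scaling by \<open>\<parallel>v\<parallel>\<close> turns a loss of \<open>\<beta>\<close> into \<open>\<parallel>v\<parallel> \<beta>\<close>, and these losses must add up to less than \<open>\<tau>\<close>.
    The summand 1 keeps the denominator positive.\<close>
  define \<tau> where "\<tau> = \<phi> (Lp_class M p s) - ((SUP F\<in>nv_unit_ball (Lp M p). \<phi> F) - \<alpha>)"
  define \<beta> where "\<beta> = \<tau> / (1 + (\<Sum>v\<in>V. norm v))"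
  have tau: "\<tau> > 0" using s(3) by (simp add: \<tau>_def)
  have sum_nonneg: "0 \<le> (\<Sum>v\<in>V. norm v)" by (simp add: sum_nonneg)
  then have beta: "\<beta> > 0" "(\<Sum>v\<in>V. norm v) * \<beta> < \<tau>"
    using tau by (auto simp: \<beta>_def field_simps)
  have "\<forall>v. \<exists>y z. norm y \<le> 1 \<and> norm z \<le> 1 \<and> d \<le> norm (y - z) \<and>
        (\<forall>x. norm x \<le> 1 \<longrightarrow> \<psi> v x \<le> \<psi> v y + \<beta> \<and> \<psi> v x \<le> \<psi> v z + \<beta>)"
    using d[OF psi beta(1)] by blast
  then obtain Y Z where
    Y: "\<And>v. norm (Y v) \<le> 1" "\<And>v x. norm x \<le> 1 \<Longrightarrow> \<psi> v x \<le> \<psi> v (Y v) + \<beta>" and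
    Z: "\<And>v. norm (Z v) \<le> 1" "\<And>v x. norm x \<le> 1 \<Longrightarrow> \<psi> v x \<le> \<psi> v (Z v) + \<beta>" and
    YZ: "\<And>v. d \<le> norm (Y v - Z v)"
    by metis
  have in_slice: "Lp_class M p (\<lambda>t. norm (s t) *\<^sub>R W (s t)) \<in> slice (Lp M p) \<phi> \<alpha>"
    if W: "\<And>v. norm (W v) \<le> 1" "\<And>v x. norm x \<le> 1 \<Longrightarrow> \<psi> v x \<le> \<psi> v (W v) + \<beta>" for W
  proof -
    have WL: "(\<lambda>t. norm (s t) *\<^sub>R W (s t)) \<in> Lp_fun M p"
      by (intro L simple_function_compose1[OF s(1)])
    have "Lp_norm M p (\<lambda>t. norm (s t) *\<^sub>R W (s t)) \<le> Lp_norm M p s"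
      using W(1) by (intro Lp_norm_mono[OF p WL L[OF s(1)]]) (simp add: mult_left_le)
    then have ball: "Lp_class M p (\<lambda>t. norm (s t) *\<^sub>R W (s t)) \<in> nv_unit_ball (Lp M p)"
      using s(2) by (simp add: Lp_class_in_unit_ball[OF WL])
    have le: "\<psi> v v \<le> \<psi> v (norm v *\<^sub>R W v) + norm v * \<beta>" for v
    proof -
      have "\<psi> v v = norm v * \<psi> v (v /\<^sub>R norm v)"
        by (cases "v = 0") (simp_all add: linear_simps[OF psi])
      also have "\<dots> \<le> norm v * (\<psi> v (W v) + \<beta>)"
        by (intro mult_left_mono W(2)) (auto simp: divide_simps)
      finally show ?thesis
        by (simp add: linear_simps[OF psi] distrib_left)
    qed
    have "\<phi> (Lp_class M p s) = (\<Sum>v\<in>V. \<psi> v v)"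
      using split[of "\<lambda>v. v"] by simp
    also have "\<dots> \<le> (\<Sum>v\<in>V. \<psi> v (norm v *\<^sub>R W v) + norm v * \<beta>)"
      by (intro sum_mono le)
    also have "\<dots> = \<phi> (Lp_class M p (\<lambda>t. norm (s t) *\<^sub>R W (s t))) + (\<Sum>v\<in>V. norm v) * \<beta>"
      using split[of "\<lambda>v. norm v *\<^sub>R W v"] by (simp add: sum.distrib sum_distrib_right)
    finally show ?thesis
      using ball beta(2) by (simp add: slice_def \<tau>_def)
  qed
  let ?g = "\<lambda>t. norm (s t) *\<^sub>R Y (s t)" and ?h = "\<lambda>t. norm (s t) *\<^sub>R Z (s t)"
  have gh: "?g \<in> Lp_fun M p" "?h \<in> Lp_fun M p"
    by (intro L simple_function_compose1[OF s(1)])+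
  have "d = Lp_norm M p (\<lambda>t. d *\<^sub>R s t)"
    using \<open>d > 0\<close> s(2) by (simp add: Lp_norm_scaleR[OF p])
  also have "\<dots> \<le> Lp_norm M p (\<lambda>t. ?g t + (- 1) *\<^sub>R ?h t)"
  proof (rule Lp_norm_mono[OF p])
    show "(\<lambda>t. d *\<^sub>R s t) \<in> Lp_fun M p"
      by (intro Lp_fun_scaleR L s(1))
    show "(\<lambda>t. ?g t + (- 1) *\<^sub>R ?h t) \<in> Lp_fun M p"
      by (intro Lp_fun_add Lp_fun_scaleR gh p)
    fix t
    have "norm (?g t + (- 1) *\<^sub>R ?h t) = norm (s t) * norm (Y (s t) - Z (s t))"
      by (simp flip: scaleR_diff_right)
    moreover have "norm (s t) * d \<le> norm (s t) * norm (Y (s t) - Z (s t))"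
      by (intro mult_left_mono YZ) simp
    ultimately show "norm (d *\<^sub>R s t) \<le> norm (?g t + (- 1) *\<^sub>R ?h t)"
      using \<open>d > 0\<close> by (simp add: mult.commute)
  qed
  also have "\<dots> = nv_dist (Lp M p) (Lp_class M p ?g) (Lp_class M p ?h)"
    by (rule nv_dist_Lp[OF p gh, symmetric])
  also have "\<dots> \<le> nv_diameter (Lp M p) (slice (Lp M p) \<phi> \<alpha>)"
    using in_slice[of Y] in_slice[of Z] Y Z by (intro nv_dist_Lp_le_diameter[OF p]) (auto simp: slice_def)
  also have "\<dots> < d" by (rule phi(4))
  finally show False by simp
qed

end
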